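(* Let $A\subset\mathbb{N}$ and $n\in\mathbb{N}$ with $n\notin A$. Then the following are equivalent: (a) for every $a\in\mathbb{N}$, if $an\in\Pr(A)$ then $an\in\Pr(A\cup\{n\})$; (b) $A\prec A\cup\{n\}$.
   Context: For $n\in\mathbb{N}$, $D(n)$ is the set of positive divisors of $n$. For $A\subset\mathbb{N}$, $S_A=\sum_{a\in A}a$ ($S_\emptyset=0$, $S_A=+\infty$ for infinite $A$), and $A$ is a practical set if every non-negative integer $k\le S_A$ is a sum of distinct elements of $A$. A number $m\in\mathbb{N}$ is $A$-practical if $D(m)\cap A$ is a practical set, and $\Pr(A)$ is the set of all $A$-practical numbers. For $A,A'\subset\mathbb{N}$, $A\prec A'$ means $A\subseteq A'$ and $\Pr(A)\subseteq\Pr(A')$. *)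

theory Defs
  imports Main "HOL-Library.Extended_Nat"
begin

text \<open>
  Here the natural numbers start at 1; the type \<^typ>\<open>nat\<close> contains 0, so positivity is stated
  explicitly.
\<close>

definition pos_nats :: "nat set" where
  "pos_nats = {1..}"

definition divisor_set :: "nat \<Rightarrow> nat set" where
  "divisor_set n = {d \<in> pos_nats. d dvd n}"

definition set_sum :: "nat set \<Rightarrow> enat" where
  "set_sum A = (if finite A then enat (\<Sum>a\<in>A. a) else \<infinity>)"

definition practical_set :: "nat set \<Rightarrow> bool" where
  "practical_set A \<longleftrightarrow>
     (\<forall>k::nat. enat k \<le> set_sum A \<longrightarrow> (\<exists>B. finite B \<and> B \<subseteq> A \<and> k = (\<Sum>b\<in>B. b)))"

definition practical_number :: "nat set \<Rightarrow> nat \<Rightarrow> bool" where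
  "practical_number A m \<longleftrightarrow> practical_set (divisor_set m \<inter> A)"

definition Pr :: "nat set \<Rightarrow> nat set" where
  "Pr A = {m \<in> pos_nats. practical_number A m}"

definition prec_set :: "nat set \<Rightarrow> nat set \<Rightarrow> bool"  (infix \<open>\<prec>\<close> 50) where
  "A \<prec> A' \<longleftrightarrow> A \<subseteq> A' \<and> Pr A \<subseteq> Pr A'"

end

theory Submission imports Defs
begin

text \<open>Whether \<open>m\<close> is \<open>A\<close>-practical depends only on the divisors of
  \<open>m\<close> lying in \<open>A\<close>, so adjoining \<open>n\<close> can change the answer
  only when \<open>n\<close> divides \<open>m\<close>;
  \<open>practical_number_insert_not_dvd\<close> records this. Hence
  \<open>Pr A \<subseteq> Pr (A \<union> {n})\<close> has to be tested only at multiples of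
  \<open>n\<close>, and conversely the inclusion specializes to them.\<close>

lemma practical_number_insert_not_dvd:
  assumes "\<not> n dvd m"
  shows "practical_number (insert n A) m \<longleftrightarrow> practical_number A m"
proof -
  have "divisor_set m \<inter> insert n A = divisor_set m \<inter> A"
    using assms by (auto simp: divisor_set_def)
  then show ?thesis
    by (simp add: practical_number_def)
qed

theorem theorem3p15:
  fixes A :: "nat set" and n :: nat
  assumes "A \<subseteq> pos_nats" and "n \<in> pos_nats" and "n \<notin> A"
  shows "(\<forall>a\<in>pos_nats. a * n \<in> Pr A \<longrightarrow> a * n \<in> Pr (A \<union> {n})) \<longleftrightarrow> A \<prec> A \<union> {n}"
proof
  assume multiples: "\<forall>a\<in>pos_nats. a * n \<in> Pr A \<longrightarrow> a * n \<in> Pr (A \<union> {n})"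
  have "m \<in> Pr (A \<union> {n})" if m: "m \<in> Pr A" for m
  proof (cases "n dvd m")
    case True
    then obtain a where a: "m = a * n"
      by (metis dvdE mult.commute)
    \<comment> \<open>The cofactor must be positive before \<open>multiples\<close> applies:
      \<open>a = 0\<close> would give \<open>m = 0\<close>, which \<open>Pr\<close>
      excludes.\<close>
    with m have "a \<in> pos_nats"
      by (cases a) (auto simp: Pr_def pos_nats_def)
    with multiples m a show ?thesis
      by blast
  next
    case False
    with m show ?thesis
      by (simp add: Pr_def practical_number_insert_not_dvd)
  qed
  then show "A \<prec> A \<union> {n}"
    by (auto simp: prec_set_def)
next
  assume "A \<prec> A \<union> {n}"
  then show "\<forall>a\<in>pos_nats. a * n \<in> Pr A \<longrightarrow> a * n \<in> Pr (A \<union> {n})"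
    by (auto simp: prec_set_def)
qed

end
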